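(* Let $\alpha>1$ and let $Y_{2\alpha,\frac1\alpha}(t)=F_{2\alpha}(S_{\frac1\alpha}(t))$ be the symmetric fractional Fresnel pseudoprocess time-changed with an independent stable subordinator of exponent $\frac1\alpha$. Then for every $t>0$ its distribution has the probability density function $$f(x)=\frac{1}{2\pi}\left[\frac{t\cos\frac{\pi}{2\alpha}}{x^2+t^2-2xt\sin\frac{\pi}{2\alpha}}+\frac{t\cos\frac{\pi}{2\alpha}}{x^2+t^2+2xt\sin\frac{\pi}{2\alpha}}\right]=\frac{t\cos\frac{\pi}{2\alpha}}{\pi}\cdot\frac{x^2+t^2}{x^4+t^4+2x^2t^2\cos\frac{\pi}{\alpha}},\qquad x\in\mathbb{R}.$$ Moreover: (i) if $1<\alpha<3$, then $f'$ has exactly three real roots, $x=0$ and $x=\pm t\sqrt{2\sin\frac{\pi}{2\alpha}-1}$, and $f$ is bimodal, with two modes (maxima) at $x=\pm t\sqrt{2\sin\frac{\pi}{2\alpha}-1}$ and a (local) minimum at $x=0$; (ii) if $\alpha\ge3$, then the only real root of $f'$ is $x=0$, and $f$ is unimodal with its maximum at $x=0$.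
   Context: For real $\alpha>1$ the generalized Airy function is $\mathrm{Ai}_{\alpha}(x)=\frac{1}{\pi}\int_0^{+\infty}\cos\left(sx+\frac{s^{\alpha}}{\alpha}\right)ds$, $x\in\mathbb{R}$ (convergent improper Riemann integral). The pseudo-density (density of a signed measure) of the fractional Fresnel pseudoprocess $F_{2\alpha}(t)$ is $$u_{2\alpha}(x,t)=\frac{1}{2(\alpha t)^{1/\alpha}}\left[\mathrm{Ai}_{\alpha}\left(\frac{x}{(\alpha t)^{1/\alpha}}\right)+\mathrm{Ai}_{\alpha}\left(-\frac{x}{(\alpha t)^{1/\alpha}}\right)\right],\qquad x\in\mathbb{R},\ t>0.$$ The stable subordinator $S_\theta(t)$, $\theta\in(0,1)$, is the positive random variable with characteristic function $\mathbb{E}[e^{i\gamma S_{\theta}(t)}]=\exp\left(-t|\gamma|^{\theta}e^{-i\frac{\pi\theta}{2}\operatorname{sgn}\gamma}\right)$; let $h_\theta(s,t)$, $s>0$, be its probability density. The distribution of $F_{2\alpha}(S_\theta(t))$ is by definition the signed measure on $\mathbb{R}$ with density $x\mapsto\int_0^{+\infty}u_{2\alpha}(x,s)\,h_{\theta}(s,t)\,ds$. *)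

theory Defs
  imports "HOL-Probability.Probability"
begin

text \<open>The integral over the half-line converges only conditionally, hence the limit of integrals
  over \<open>[0, R]\<close> and not a Lebesgue integral.\<close>

definition gen_airy :: "real \<Rightarrow> real \<Rightarrow> real" where
  "gen_airy \<alpha> x =
     1 / pi * Lim at_top (\<lambda>R. integral {0..R} (\<lambda>s. cos (s * x + s powr \<alpha> / \<alpha>)))"

text \<open>The pseudo-density \<open>u\<^sub>2\<^sub>\<alpha>(x, t)\<close> of the fractional Fresnel pseudoprocess; note that the parameter
  is \<open>\<alpha>\<close>, not \<open>2\<alpha>\<close>.\<close>

definition fresnel_density :: "real \<Rightarrow> real \<Rightarrow> real \<Rightarrow> real" where
  "fresnel_density \<alpha> x t =
     1 / (2 * (\<alpha> * t) powr (1 / \<alpha>)) *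
       (gen_airy \<alpha> (x / (\<alpha> * t) powr (1 / \<alpha>)) + gen_airy \<alpha> (- (x / (\<alpha> * t) powr (1 / \<alpha>))))"

text \<open>Only the one-dimensional laws of the subordinator are constrained: nothing else enters the
  distribution of the time-changed pseudoprocess at a fixed time.\<close>

definition stable_subordinator :: "'a measure \<Rightarrow> real \<Rightarrow> (real \<Rightarrow> 'a \<Rightarrow> real) \<Rightarrow> bool" where
  "stable_subordinator M \<theta> S \<longleftrightarrow>
     prob_space M \<and>
     (\<forall>t>0. S t \<in> borel_measurable M \<and> (AE \<omega> in M. 0 < S t \<omega>) \<and>
        (\<forall>\<gamma>. char (distr M borel (S t)) \<gamma> =
           exp (- (of_real (t * \<bar>\<gamma>\<bar> powr \<theta>) * exp (- \<i> * of_real (pi * \<theta> / 2 * sgn \<gamma>))))))"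

text \<open>The values of \<open>p\<close> outside \<open>(0, \<infinity>)\<close> are irrelevant.\<close>

definition has_pos_density :: "'a measure \<Rightarrow> ('a \<Rightarrow> real) \<Rightarrow> (real \<Rightarrow> real) \<Rightarrow> bool" where
  "has_pos_density M X p \<longleftrightarrow>
     (\<forall>s>0. 0 \<le> p s) \<and>
     distributed M lborel X (\<lambda>s. ennreal (indicator {0<..} s * p s))"

text \<open>Signed measures on the real line are represented by real-valued functions on its Borel sets.
  Here \<open>p\<close> is the density of the independent random time. If the density of the signed measure
  were not integrable, the set function would vanish on the whole line.\<close>

definition subordinated_fresnel_distribution ::
    "real \<Rightarrow> (real \<Rightarrow> real) \<Rightarrow> real set \<Rightarrow> real" where
  "subordinated_fresnel_distribution \<alpha> p A =
     (LINT x:A|lborel. (LINT s:{0<..}|lborel. fresnel_density \<alpha> x s * p s))"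

definition has_prob_density :: "(real set \<Rightarrow> real) \<Rightarrow> (real \<Rightarrow> real) \<Rightarrow> bool" where
  "has_prob_density \<mu> f \<longleftrightarrow>
     f \<in> borel_measurable borel \<and> (\<forall>x. 0 \<le> f x) \<and>
     prob_space (density lborel (\<lambda>x. ennreal (f x))) \<and>
     (\<forall>A\<in>sets borel. \<mu> A = (LINT x:A|lborel. f x))"

definition cauchy_mixture_density :: "real \<Rightarrow> real \<Rightarrow> real \<Rightarrow> real" where
  "cauchy_mixture_density \<alpha> t x =
     1 / (2 * pi) *
       (t * cos (pi / (2 * \<alpha>)) / (x\<^sup>2 + t\<^sup>2 - 2 * x * t * sin (pi / (2 * \<alpha>))) +
        t * cos (pi / (2 * \<alpha>)) / (x\<^sup>2 + t\<^sup>2 + 2 * x * t * sin (pi / (2 * \<alpha>))))"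

definition is_local_max :: "(real \<Rightarrow> real) \<Rightarrow> real \<Rightarrow> bool" where
  "is_local_max f x \<longleftrightarrow> (\<forall>\<^sub>F y in nhds x. f y \<le> f x)"

definition is_local_min :: "(real \<Rightarrow> real) \<Rightarrow> real \<Rightarrow> bool" where
  "is_local_min f x \<longleftrightarrow> (\<forall>\<^sub>F y in nhds x. f x \<le> f y)"

text \<open>A mode of a density is a point of local maximum.\<close>

definition modes :: "(real \<Rightarrow> real) \<Rightarrow> real set" where
  "modes f = {x. is_local_max f x}"

definition unimodal :: "(real \<Rightarrow> real) \<Rightarrow> bool" where
  "unimodal f \<longleftrightarrow> card (modes f) = 1"

definition bimodal :: "(real \<Rightarrow> real) \<Rightarrow> bool" where
  "bimodal f \<longleftrightarrow> card (modes f) = 2"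

end

(* Split the Airy function of fractional order into the oscillatory integrals of
   cos (g x + s g^alpha) over g in [0, R]; then the density u(x, s) is the limit as R grows of
   (1/pi) times the integral over g in [0, R] of cos (g x) cos (s g^alpha). Averaging over the subordinator
   turns cos (s g^alpha) into Re exp (- t g exp (- i pi / (2 alpha))), a damped cosine, whose cosine transform
   is a mixture of two Cauchy densities.

   The limit and the expectation may be interchanged because, for x different from 0, the first derivative
   test bounds the truncated integrals by C (1 + s^(-1/(alpha-1))) uniformly in R, and the stable law has
   finite negative moments. These come from its Laplace transform exp (- t r^theta), which the
   characteristic function determines by Schwarz reflection: the two sides extend continuously to the real
   axis, agree there, and hence agree on the upper half-plane. *)
theory Submission
  imports Defs "HOL-Complex_Analysis.Complex_Analysis" "HOL-Real_Asymp.Real_Asymp"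
begin

subsection \<open>Oscillatory integrals\<close>

text \<open>The first derivative test, proved by comparison instead of integration by parts. Since
  \<open>\<psi>\<close> increases, the correction terms in the derivatives of (sin
  \<open>\<phi>\<close> + c) / \<open>\<psi>\<close> for c = 1 and c = -1 have fixed signs, so the
  integral of the cosine lies between two endpoint differences. The terms at \<open>b\<close> have
  the favourable sign and drop out, hence only \<open>\<psi> a\<close> enters the bound.\<close>

lemma van_der_corput_first:
  fixes \<phi> \<psi> \<psi>' :: "real \<Rightarrow> real"
  assumes ab: "a \<le> b"
    and \<phi>: "\<And>x. x \<in> {a..b} \<Longrightarrow> (\<phi> has_real_derivative \<psi> x) (at x)"
    and \<psi>: "\<And>x. x \<in> {a..b} \<Longrightarrow> (\<psi> has_real_derivative \<psi>' x) (at x)"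
    and pos: "\<And>x. x \<in> {a..b} \<Longrightarrow> 0 < \<psi> x"
    and mono: "\<And>x. x \<in> {a..b} \<Longrightarrow> 0 \<le> \<psi>' x"
  shows "\<bar>integral {a..b} (\<lambda>x. cos (\<phi> x))\<bar> \<le> 2 / \<psi> a"
proof -
  have cont: "continuous_on {a..b} (\<lambda>x. cos (\<phi> x))"
    using \<phi> by (intro continuous_intros DERIV_continuous_on) (auto intro: DERIV_subset)
  have hi: "((\<lambda>x. cos (\<phi> x)) has_integral integral {a..b} (\<lambda>x. cos (\<phi> x))) {a..b}"
    using cont by (intro integrable_integral integrable_continuous_real)
  \<comment> \<open>The functions \<open>(sin \<phi> + c) / \<psi>\<close> with \<open>c = 1\<close> and \<open>c = - 1\<close> have derivatives below and above \<open>cos \<phi>\<close>.\<close>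
  have ftc: "((\<lambda>x. cos (\<phi> x) - (sin (\<phi> x) + c) * \<psi>' x / (\<psi> x)\<^sup>2) has_integral
      ((sin (\<phi> b) + c) / \<psi> b - (sin (\<phi> a) + c) / \<psi> a)) {a..b}" for c
  proof (rule fundamental_theorem_of_calculus[OF ab])
    fix x assume x: "x \<in> {a..b}"
    have "((\<lambda>x. (sin (\<phi> x) + c) / \<psi> x) has_real_derivative
        cos (\<phi> x) - (sin (\<phi> x) + c) * \<psi>' x / (\<psi> x)\<^sup>2) (at x within {a..b})"
      using pos[OF x] 
      by (auto intro!: derivative_eq_intros DERIV_subset[OF \<phi>[OF x]] DERIV_subset[OF \<psi>[OF x]]
          simp: field_simps power2_eq_square)
    then show "((\<lambda>x. (sin (\<phi> x) + c) / \<psi> x) has_vector_derivative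
        cos (\<phi> x) - (sin (\<phi> x) + c) * \<psi>' x / (\<psi> x)\<^sup>2) (at x within {a..b})"
      by (simp add: has_real_derivative_iff_has_vector_derivative)
  qed
  have sin_bounds: "0 \<le> sin y + 1" "sin y + -1 \<le> 0" for y :: real
    using sin_ge_minus_one[of y] sin_le_one[of y] by linarith+
  have "(sin (\<phi> b) + 1) / \<psi> b - (sin (\<phi> a) + 1) / \<psi> a \<le> integral {a..b} (\<lambda>x. cos (\<phi> x))"
    using mono sin_bounds by (intro has_integral_le[OF ftc hi]) auto
  moreover have "integral {a..b} (\<lambda>x. cos (\<phi> x)) \<le> (sin (\<phi> b) + -1) / \<psi> b - (sin (\<phi> a) + -1) / \<psi> a"
    using mono sin_bounds
    by (intro has_integral_le[OF hi ftc]) (auto intro!: divide_nonpos_nonneg mult_nonpos_nonneg)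
  moreover have "0 \<le> (sin (\<phi> b) + 1) / \<psi> b"
    using pos[of b] ab sin_bounds by (intro divide_nonneg_nonneg) (auto simp: less_imp_le)
  moreover have "(sin (\<phi> b) + -1) / \<psi> b \<le> 0"
    using pos[of b] ab sin_bounds by (intro divide_nonpos_nonneg) (auto simp: less_imp_le)
  moreover have "(sin (\<phi> a) + 1) / \<psi> a \<le> 2 / \<psi> a" "- ((sin (\<phi> a) + -1) / \<psi> a) \<le> 2 / \<psi> a"
    using pos[of a] ab sin_bounds[of "\<phi> a"] by (auto simp: divide_le_cancel minus_divide_left simp del: divide_minus_left)
  ultimately show ?thesis by linarith
qed

text \<open>The truncated Airy integral with a free coefficient: \<open>b\<close> = 1 / alpha is the
  original one, and later \<open>b\<close> is the random time. Carrying the time in the phase,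
  rather than in a rescaled argument, lets it be averaged under the integral sign.\<close>

definition osc :: "real \<Rightarrow> real \<Rightarrow> real \<Rightarrow> real \<Rightarrow> real" where
  "osc \<alpha> y b R = integral {0..R} (\<lambda>s. cos (s * y + b * s powr \<alpha>))"

lemma continuous_on_osc_integrand:
  assumes "1 < \<alpha>" "0 \<le> a"
  shows "continuous_on {a..R} (\<lambda>s::real. cos (s * y + b * s powr \<alpha>))"
  using assms by (auto intro!: continuous_intros continuous_on_powr')

lemma osc_diff:
  assumes "1 < \<alpha>" "0 \<le> a" "a \<le> R"
  shows "osc \<alpha> y b R = osc \<alpha> y b a + integral {a..R} (\<lambda>s. cos (s * y + b * s powr \<alpha>))"
  unfolding osc_def using assms 
  by (intro Henstock_Kurzweil_Integration.integral_combine[symmetric] integrable_continuous_real 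
      continuous_on_osc_integrand) auto

text \<open>The phase derivative y + b alpha s^(alpha - 1) increases with s, so positivity at
  \<open>a\<close> suffices for the first derivative test. The lower limit is kept away from 0,
  where s^(alpha - 2) may be singular.\<close>

lemma osc_tail_bound:
  assumes "1 < \<alpha>" "0 < b" "0 < a" "a \<le> R" and pos: "0 < y + b * \<alpha> * a powr (\<alpha> - 1)"
  shows "\<bar>osc \<alpha> y b R - osc \<alpha> y b a\<bar> \<le> 2 / (y + b * \<alpha> * a powr (\<alpha> - 1))"
proof -
  have "\<bar>integral {a..R} (\<lambda>s. cos (s * y + b * s powr \<alpha>))\<bar> \<le> 2 / (y + b * \<alpha> * a powr (\<alpha> - 1))"
  proof (rule van_der_corput_first[where \<psi>' = "\<lambda>s. b * \<alpha> * ((\<alpha> - 1) * s powr (\<alpha> - 2))"])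
    fix x assume x: "x \<in> {a..R}"
    show "((\<lambda>s. s * y + b * s powr \<alpha>) has_real_derivative y + b * \<alpha> * x powr (\<alpha> - 1)) (at x)"
      using x assms by (auto intro!: derivative_eq_intros)
    show "((\<lambda>s. y + b * \<alpha> * s powr (\<alpha> - 1)) has_real_derivative
        b * \<alpha> * ((\<alpha> - 1) * x powr (\<alpha> - 2))) (at x)"
      using x assms by (auto intro!: derivative_eq_intros)
    have "a powr (\<alpha> - 1) \<le> x powr (\<alpha> - 1)"
      using x assms by (intro powr_mono2) auto
    then have "b * \<alpha> * a powr (\<alpha> - 1) \<le> b * \<alpha> * x powr (\<alpha> - 1)"
      using assms by (intro mult_left_mono) auto
    then show "0 < y + b * \<alpha> * x powr (\<alpha> - 1)" using pos by linarith
    show "0 \<le> b * \<alpha> * ((\<alpha> - 1) * x powr (\<alpha> - 2))"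
      using assms by simp
  qed fact
  then show ?thesis using osc_diff[of \<alpha> a R y b] assms by simp
qed

text \<open>Cauchy criterion: the phase derivative tends to infinity, so the tail bound tends to
  0.\<close>

lemma osc_convergent:
  assumes "1 < \<alpha>" "0 < b"
  shows "\<exists>L. ((\<lambda>R. osc \<alpha> y b R) \<longlongrightarrow> L) at_top"
proof -
  have "cauchy_filter (filtermap (osc \<alpha> y b) at_top)"
    unfolding cauchy_filter_metric_filtermap
  proof (intro allI impI)
    fix e :: real assume e: "0 < e"
    have lim: "filterlim (\<lambda>a. y + b * \<alpha> * a powr (\<alpha> - 1)) at_top at_top"
      using assms by real_asymp
    have "\<forall>\<^sub>F a in at_top. y + b * \<alpha> * a powr (\<alpha> - 1) > 2 / e"
      using lim by (simp add: filterlim_at_top_dense)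
    then have "\<forall>\<^sub>F a in at_top. y + b * \<alpha> * a powr (\<alpha> - 1) > 2 / e \<and> a > 0"
      using eventually_gt_at_top[of 0] by eventually_elim auto
    then obtain A where A: "\<And>a. a \<ge> A \<Longrightarrow> y + b * \<alpha> * a powr (\<alpha> - 1) > 2 / e \<and> a > 0"
      by (auto simp: eventually_at_top_linorder)
    have *: "dist (osc \<alpha> y b R) (osc \<alpha> y b R') < e" if "A \<le> R" "R \<le> R'" for R R'
    proof -
      have p: "0 < 2 / e" using e by simp
      have "\<bar>osc \<alpha> y b R' - osc \<alpha> y b R\<bar> \<le> 2 / (y + b * \<alpha> * R powr (\<alpha> - 1))"
        using A[of R] A[of R'] p assms that order.strict_trans[OF p] by (intro osc_tail_bound) auto
      also have "\<dots> < e"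
        using A[of R] that e p
        by (smt (verit, best) mult.commute pos_divide_less_eq)
      finally show ?thesis by (simp add: dist_real_def)
    qed
    show "\<exists>P. eventually P at_top \<and> (\<forall>R R'. P R \<and> P R' \<longrightarrow> dist (osc \<alpha> y b R) (osc \<alpha> y b R') < e)"
      by (rule exI[of _ "\<lambda>R. R \<ge> A"]) (metis * dist_commute eventually_ge_at_top linorder_le_cases)
  qed
  then have "convergent_filter (filtermap (osc \<alpha> y b) at_top)"
    by (rule cauchy_filter_convergent)
  then show ?thesis
    by (auto simp: convergent_filter.simps filterlim_def)
qed

text \<open>Up to the splitting point the integral is bounded by its length, and beyond it the first
  derivative test gives 2 / |y|. The bound is uniform in \<open>R\<close> and depends on
  \<open>b\<close> only through a negative power, so it stays integrable when \<open>b\<close> is a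
  random variable with a finite moment of order -1 / (alpha - 1).\<close>

lemma osc_bound:
  assumes "1 < \<alpha>" "0 < b" "y \<noteq> 0" "0 \<le> R"
  shows "\<bar>osc \<alpha> y b R\<bar> \<le> (2 * \<bar>y\<bar> / \<alpha>) powr (1 / (\<alpha> - 1)) * b powr (- (1 / (\<alpha> - 1))) + 2 / \<bar>y\<bar>"
proof -
  \<comment> \<open>Beyond \<open>g\<close> the derivative of the phase is at least \<open>\<bar>y\<bar>\<close>.\<close>
  define g where "g = (2 * \<bar>y\<bar> / (b * \<alpha>)) powr (1 / (\<alpha> - 1))"
  have g: "g > 0" using assms by (simp add: g_def)
  have trivial: "\<bar>osc \<alpha> y b r\<bar> \<le> r" if "0 \<le> r" for r
    unfolding osc_def
    using integral_bound[of 0 r "\<lambda>s. cos (s * y + b * s powr \<alpha>)" 1]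
      continuous_on_osc_integrand[of \<alpha> 0 r y b] assms that by simp
  \<comment> \<open>The factor 2 leaves a phase derivative y + 2 |y|, which is at least |y| even for
    negative \<open>y\<close>.\<close>
  have gp: "b * \<alpha> * g powr (\<alpha> - 1) = 2 * \<bar>y\<bar>"
    using assms by (simp add: g_def powr_powr)
  have "\<bar>osc \<alpha> y b R\<bar> \<le> g + 2 / \<bar>y\<bar>"
  proof (cases "R \<le> g")
    case True
    then show ?thesis using trivial[of R] assms by (smt (verit) divide_nonneg_nonneg)
  next
    case False
    have "\<bar>osc \<alpha> y b R - osc \<alpha> y b g\<bar> \<le> 2 / (y + b * \<alpha> * g powr (\<alpha> - 1))"
      using False assms g gp by (intro osc_tail_bound) auto
    also have "\<dots> \<le> 2 / \<bar>y\<bar>"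
      using gp assms by (intro divide_left_mono) (auto intro!: mult_pos_pos)
    finally show ?thesis using trivial[of g] g by linarith
  qed
  moreover have "g = (2 * \<bar>y\<bar> / \<alpha>) powr (1 / (\<alpha> - 1)) * b powr (- (1 / (\<alpha> - 1)))"
    using assms by (simp add: g_def powr_divide powr_mult powr_minus field_simps)
  ultimately show ?thesis by simp
qed

lemma osc_scale:
  assumes "0 < c" "0 \<le> R"
  shows "osc \<alpha> y b (c * R) = c * osc \<alpha> (c * y) (b * c powr \<alpha>) R"
proof -
  have "(\<lambda>x. x / c) ` {0..c * R} = {0..R}"
    using assms by (auto simp: image_iff field_simps intro!: bexI[of _ "c * _"])
  then have "osc \<alpha> (c * y) (b * c powr \<alpha>) R
      = integral ((\<lambda>x. x / c) ` {0..c * R}) (\<lambda>s. cos (c * s * y + b * (c * s) powr \<alpha>))"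
    using assms by (auto intro!: Henstock_Kurzweil_Integration.integral_cong simp: osc_def powr_mult mult_ac)
  also have "\<dots> = (1 / \<bar>c\<bar>) *\<^sub>R osc \<alpha> y b (c * R)"
    unfolding osc_def using assms
    by (intro integral_stretch_real[where f = "\<lambda>s. cos (s * y + b * s powr \<alpha>)"]) auto
  finally show ?thesis using assms by simp
qed

text \<open>Change of variable by the factor c = (alpha s)^(1 / alpha), chosen so that c^alpha /
  alpha = s: it moves the scaling from the argument of the Airy function into the coefficient of the
  phase. Convergence is a hypothesis because \<open>Lim\<close> can be evaluated only from a known
  limit.\<close>

lemma gen_airy_eq:
  assumes \<alpha>: "1 < \<alpha>" and s: "0 < s" and L: "(osc \<alpha> x s \<longlongrightarrow> L) at_top"
  shows "gen_airy \<alpha> (x / (\<alpha> * s) powr (1 / \<alpha>)) = (\<alpha> * s) powr (1 / \<alpha>) * L / pi"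
proof -
  define c where "c = (\<alpha> * s) powr (1 / \<alpha>)"
  have c: "c > 0" using assms by (simp add: c_def)
  have ca: "c powr \<alpha> = \<alpha> * s" using assms by (simp add: c_def powr_powr)
  have "((\<lambda>R. c * osc \<alpha> x s (R / c)) \<longlongrightarrow> c * L) at_top"
    using c by (intro tendsto_intros filterlim_compose[OF L]) real_asymp
  moreover have "\<forall>\<^sub>F R in at_top. c * osc \<alpha> x s (R / c) = osc \<alpha> (x / c) (1 / \<alpha>) R"
    using eventually_ge_at_top[of 0]
  proof eventually_elim
    case (elim R)
    then show ?case using osc_scale[of c "R / c" \<alpha> "x / c" "1 / \<alpha>"] c ca \<alpha> by simp
  qed
  ultimately have "((\<lambda>R. osc \<alpha> (x / c) (1 / \<alpha>) R) \<longlongrightarrow> c * L) at_top"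
    by (rule Lim_transform_eventually)
  then have "Lim at_top (\<lambda>R. osc \<alpha> (x / c) (1 / \<alpha>) R) = c * L"
    by (intro tendsto_Lim) auto
  then show ?thesis by (simp add: gen_airy_def osc_def c_def)
qed

text \<open>The factor c gained by the change of variable cancels the prefactor 1 / (2 c) of the
  density, leaving 1 / (2 pi).\<close>

lemma fresnel_density_lim:
  assumes "1 < \<alpha>" "0 < s"
  shows "((\<lambda>R. (osc \<alpha> x s R + osc \<alpha> (- x) s R) / (2 * pi)) \<longlongrightarrow> fresnel_density \<alpha> x s) at_top"
proof -
  obtain L L' where L: "(osc \<alpha> x s \<longlongrightarrow> L) at_top" and L': "(osc \<alpha> (- x) s \<longlongrightarrow> L') at_top"
    using osc_convergent assms by meson
  have "fresnel_density \<alpha> x s = (L + L') / (2 * pi)"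
    using gen_airy_eq[OF assms L] gen_airy_eq[OF assms L'] assms
    by (simp add: fresnel_density_def field_simps)
  then show ?thesis using L L' by (auto intro!: tendsto_intros)
qed

subsection \<open>Laplace transform and negative moments of stable laws\<close>

lemma norm_exp_times_nonneg_le_1:
  assumes "0 \<le> Im w" "0 \<le> x"
  shows "norm (exp (\<i> * w * of_real x)) \<le> 1"
  using assms by (simp add: norm_exp_eq_Re)

text \<open>Dominated convergence with the constant 1, available because X > 0. The closed
  half-plane is essential: the reflection argument needs continuity up to the real axis.\<close>

lemma continuous_on_fourier_transform:
  assumes "prob_space M" and [measurable]: "X \<in> borel_measurable M" and X: "AE \<omega> in M. 0 < X \<omega>"
  shows "continuous_on {w. 0 \<le> Im w} (\<lambda>w. \<integral>\<omega>. exp (\<i> * w * of_real (X \<omega>)) \<partial>M)"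
  unfolding continuous_on_sequentially
proof (intro allI ballI impI, elim conjE)
  interpret prob_space M by fact
  fix z :: "nat \<Rightarrow> complex" and w assume z: "\<forall>n. z n \<in> {w. 0 \<le> Im w}" "z \<longlonglongrightarrow> w"
  show "((\<lambda>w. \<integral>\<omega>. exp (\<i> * w * of_real (X \<omega>)) \<partial>M) \<circ> z) \<longlonglongrightarrow>
      (\<integral>\<omega>. exp (\<i> * w * of_real (X \<omega>)) \<partial>M)"
    unfolding comp_def
  proof (rule integral_dominated_convergence[where w = "\<lambda>_. 1"])
    show "AE \<omega> in M. (\<lambda>n. exp (\<i> * z n * of_real (X \<omega>))) \<longlonglongrightarrow> exp (\<i> * w * of_real (X \<omega>))"
      using z by (intro AE_I2) (intro tendsto_intros)
    show "AE \<omega> in M. norm (exp (\<i> * z n * of_real (X \<omega>))) \<le> 1" for n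
      using X by eventually_elim (use z in \<open>auto intro!: norm_exp_times_nonneg_le_1\<close>)
  qed auto
qed

text \<open>Differentiation under the integral sign. In a ball of half the distance to the real axis
  the difference quotients are bounded by a constant, which is integrable for a probability
  measure.\<close>

lemma holomorphic_on_fourier_transform:
  assumes "prob_space M" and [measurable]: "X \<in> borel_measurable M" and X: "AE \<omega> in M. 0 < X \<omega>"
  shows "(\<lambda>w. \<integral>\<omega>. exp (\<i> * w * of_real (X \<omega>)) \<partial>M) holomorphic_on {w. 0 < Im w}"
proof (rule holomorphic_on_subset)
  interpret prob_space M by fact
  let ?F = "\<lambda>w. \<integral>\<omega>. exp (\<i> * w * of_real (X \<omega>)) \<partial>M"
  have int: "integrable M (\<lambda>\<omega>. exp (\<i> * w * of_real (X \<omega>)))" if "0 \<le> Im w" for w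
  proof (rule integrable_const_bound[where B = 1])
    show "AE \<omega> in M. norm (exp (\<i> * w * of_real (X \<omega>))) \<le> 1"
      using X by eventually_elim (use that in \<open>auto intro!: norm_exp_times_nonneg_le_1\<close>)
  qed measurable
  have "?F field_differentiable at w" if w: "0 < Im w" for w
  proof -
    define d where "d = Im w"
    define B where "B = ball w (d / 2)"
    have d: "0 < d" using w by (simp add: d_def)
    have Im: "Im z \<ge> d / 2" if "z \<in> B" for z
      using that abs_Im_le_cmod[of "w - z"] by (auto simp: B_def d_def dist_norm)
    have diff_bound: "norm (exp (\<i> * z * of_real x) - exp (\<i> * w * of_real x)) \<le> 2 / d * norm (z - w)"
      if z: "z \<in> B" and x: "0 < x" for z x
    proof (rule field_differentiable_bound[where S = B and f' = "\<lambda>z. \<i> * of_real x * exp (\<i> * z * of_real x)"])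
      fix u assume u: "u \<in> B"
      show "((\<lambda>z. exp (\<i> * z * of_real x)) has_field_derivative \<i> * of_real x * exp (\<i> * u * of_real x))
          (at u within B)"
        by (auto intro!: derivative_eq_intros)
      have "norm (\<i> * of_real x * exp (\<i> * u * of_real x)) = x * exp (- (Im u * x))"
        using x by (simp add: norm_mult norm_exp_eq_Re)
      also have "\<dots> \<le> x * exp (- (d / 2 * x))"
        using x Im[OF u] by (intro mult_left_mono) auto
      also have "\<dots> \<le> 2 / d"
      proof -
        \<comment> \<open>The exponential decay absorbs the factor x produced by differentiation, so
          no moment of X is required.\<close>
        have "d / 2 * x \<le> exp (d / 2 * x)" using exp_ge_add_one_self[of "d / 2 * x"] by linarith
        then show ?thesis using d by (simp add: exp_minus field_simps)
      qed
      finally show "norm (\<i> * of_real x * exp (\<i> * u * of_real x)) \<le> 2 / d" .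
    qed (use d z in \<open>auto simp: B_def\<close>)
    have "(?F has_field_derivative (\<integral>\<omega>. \<i> * of_real (X \<omega>) * exp (\<i> * w * of_real (X \<omega>)) \<partial>M)) (at w within B)"
      unfolding has_field_derivative_iff tendsto_at_iff_sequentially comp_def
    proof (intro allI impI)
      fix z :: "nat \<Rightarrow> complex" assume z: "\<forall>n. z n \<in> B - {w}" "z \<longlonglongrightarrow> w"
      have "(\<lambda>n. \<integral>\<omega>. (exp (\<i> * z n * of_real (X \<omega>)) - exp (\<i> * w * of_real (X \<omega>))) / (z n - w) \<partial>M)
          \<longlonglongrightarrow> (\<integral>\<omega>. \<i> * of_real (X \<omega>) * exp (\<i> * w * of_real (X \<omega>)) \<partial>M)"
      proof (rule integral_dominated_convergence[where w = "\<lambda>_. 2 / d"])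
        show "AE \<omega> in M. (\<lambda>n. (exp (\<i> * z n * of_real (X \<omega>)) - exp (\<i> * w * of_real (X \<omega>))) / (z n - w))
            \<longlonglongrightarrow> \<i> * of_real (X \<omega>) * exp (\<i> * w * of_real (X \<omega>))"
        proof (rule AE_I2)
          fix \<omega>
          have "((\<lambda>z. exp (\<i> * z * of_real (X \<omega>))) has_field_derivative
              \<i> * of_real (X \<omega>) * exp (\<i> * w * of_real (X \<omega>))) (at w within B)"
            by (auto intro!: derivative_eq_intros)
          then show "(\<lambda>n. (exp (\<i> * z n * of_real (X \<omega>)) - exp (\<i> * w * of_real (X \<omega>))) / (z n - w))
              \<longlonglongrightarrow> \<i> * of_real (X \<omega>) * exp (\<i> * w * of_real (X \<omega>))"
            using z unfolding has_field_derivative_iff tendsto_at_iff_sequentially comp_def by blast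
        qed
        show "AE \<omega> in M. norm ((exp (\<i> * z n * of_real (X \<omega>)) - exp (\<i> * w * of_real (X \<omega>))) / (z n - w)) \<le> 2 / d" for n
          using X
        proof eventually_elim
          case (elim \<omega>)
          show ?case using diff_bound[of "z n" "X \<omega>"] elim z by (auto simp: norm_divide divide_le_eq)
        qed
      qed auto
      moreover have "(\<integral>\<omega>. (exp (\<i> * z n * of_real (X \<omega>)) - exp (\<i> * w * of_real (X \<omega>))) / (z n - w) \<partial>M)
          = (?F (z n) - ?F w) / (z n - w)" for n
      proof -
        have "0 \<le> Im (z n)" using Im[of "z n"] z d by (metis DiffD1 order.trans half_gt_zero less_imp_le)
        then have "?F (z n) - ?F w = (\<integral>\<omega>. exp (\<i> * z n * of_real (X \<omega>)) - exp (\<i> * w * of_real (X \<omega>)) \<partial>M)"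
          using int w by (intro Bochner_Integration.integral_diff[symmetric]) auto
        then show ?thesis by simp
      qed
      ultimately show "(\<lambda>n. (?F (z n) - ?F w) / (z n - w)) \<longlonglongrightarrow>
          (\<integral>\<omega>. \<i> * of_real (X \<omega>) * exp (\<i> * w * of_real (X \<omega>)) \<partial>M)" by (simp only:)
    qed
    moreover have "at w within B = at w" using d by (intro at_within_open) (auto simp: B_def)
    ultimately show ?thesis by (auto simp: field_differentiable_def)
  qed
  then show "?F holomorphic_on {w. 0 < Im w}"
    by (auto simp: holomorphic_on_def intro: field_differentiable_at_within)
qed auto

text \<open>Identifies the exponent of the stable characteristic function as the boundary value of a
  principal power. Multiplication by -i carries the upper half-plane to the right half-plane, where
  that power is holomorphic; on the real axis the argument of -i x is -pi/2 times the sign of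
  x.\<close>

lemma minus_ii_times_powr:
  assumes "x \<noteq> 0"
  shows "(- \<i> * of_real x) powr of_real \<theta>
      = of_real (\<bar>x\<bar> powr \<theta>) * exp (- \<i> * of_real (pi * \<theta> / 2 * sgn x))"
proof -
  have "Ln (of_real \<bar>x\<bar> * (- \<i> * of_real (sgn x))) = of_real (ln \<bar>x\<bar>) + Ln (- \<i> * of_real (sgn x))"
    using assms by (subst Ln_times_of_real) (auto simp: sgn_zero_iff Ln_of_real)
  also have "Ln (- \<i> * of_real (sgn x)) = - \<i> * of_real (pi / 2 * sgn x)"
    using assms by (cases "x > 0") (auto simp: sgn_if)
  also have "of_real \<bar>x\<bar> * (- \<i> * of_real (sgn x)) = - \<i> * complex_of_real x"
    by (auto simp: sgn_if)
  finally have "Ln (- \<i> * of_real x) = of_real (ln \<bar>x\<bar>) + - \<i> * of_real (pi / 2 * sgn x)" .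
  then have "(- \<i> * of_real x) powr of_real \<theta>
      = exp (of_real (\<theta> * ln \<bar>x\<bar>) + - \<i> * of_real (pi * \<theta> / 2 * sgn x))"
    using assms by (simp only: powr_def) (simp add: algebra_simps)
  also have "\<dots> = exp (of_real (\<theta> * ln \<bar>x\<bar>)) * exp (- \<i> * of_real (pi * \<theta> / 2 * sgn x))"
    by (rule exp_add)
  also have "exp (complex_of_real (\<theta> * ln \<bar>x\<bar>)) = of_real (\<bar>x\<bar> powr \<theta>)"
    using assms by (simp add: powr_def flip: exp_of_real)
  finally show ?thesis .
qed

lemma laplace_transform_stable:
  assumes M: "prob_space M" "X \<in> borel_measurable M" "AE \<omega> in M. 0 < X \<omega>" and \<theta>: "0 < \<theta>"
    and char: "\<And>\<gamma>. char (distr M borel X) \<gamma> =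
      exp (- (of_real (t * \<bar>\<gamma>\<bar> powr \<theta>) * exp (- \<i> * of_real (pi * \<theta> / 2 * sgn \<gamma>))))"
    and "0 \<le> \<eta>"
  shows "(\<integral>\<omega>. exp (- \<eta> * X \<omega>) \<partial>M) = exp (- t * \<eta> powr \<theta>)"
proof (cases "\<eta> = 0")
  case True
  interpret prob_space M by fact
  show ?thesis using True by (simp add: prob_space)
next
  case False
  then have \<eta>: "0 < \<eta>" using assms by simp
  interpret prob_space M by fact
  note [measurable] = M(2)
  define F where "F = (\<lambda>w. \<integral>\<omega>. exp (\<i> * w * of_real (X \<omega>)) \<partial>M)"
  define G where "G = (\<lambda>w. exp (- of_real t * (- \<i> * w) powr of_real \<theta>))"
  \<comment> \<open>The origin is removed since the power formula above is for nonzero arguments;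
    the punctured plane is still connected.\<close>
  let ?S = "- {0} :: complex set"
  \<comment> \<open>The difference of transform and candidate, reflected across the real axis. Its
    zeros there become interior zeros, so the identity theorem applies.\<close>
  let ?H = "\<lambda>z. if 0 \<le> Im z then F z - G z else cnj (F (cnj z) - G (cnj z))"
  have "G holomorphic_on {w. 0 < Im w}"
    unfolding G_def by (intro holomorphic_intros) (auto simp: complex_nonpos_Reals_iff)
  then have hol: "(\<lambda>w. F w - G w) holomorphic_on (?S \<inter> {w. 0 < Im w})"
    using holomorphic_on_fourier_transform[OF M] 
    by (intro holomorphic_on_diff) (auto simp: F_def elim: holomorphic_on_subset)
  have "continuous_on {w. 0 \<le> Im w} G"
    unfolding G_def using \<theta> by (intro continuous_intros) auto
  then have cont: "continuous_on (?S \<inter> {w. 0 \<le> Im w}) (\<lambda>w. F w - G w)"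
    using continuous_on_fourier_transform[OF M] 
    by (intro continuous_on_diff) (auto simp: F_def elim: continuous_on_subset)
  have zero: "F (of_real x) - G (of_real x) = 0" if "x \<noteq> 0" for x
  proof -
    have "F (of_real x) = char (distr M borel X) x"
      by (simp add: F_def char_def integral_distr mult_ac)
    also have "\<dots> = G (of_real x)"
      unfolding char G_def minus_ii_times_powr[OF that] by (simp add: mult_ac)
    finally show ?thesis by simp
  qed
  have "?H holomorphic_on ?S"
  proof (rule Schwarz_reflection[OF _ _ hol cont])
    fix z :: complex assume "z \<in> ?S" "z \<in> \<real>"
    then show "F z - G z \<in> \<real>" using zero by (auto elim!: Reals_cases)
  qed auto
  then have "?H (\<i> * of_real \<eta>) = 0"
  proof (rule analytic_continuation[where S = ?S and U = "\<real> - {0}" and \<xi> = 1])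
    show "connected ?S" by (intro connected_punctured_universe) auto
    \<comment> \<open>Any nonzero real point would do as an accumulation point of zeros.\<close>
    have "(1::complex) islimpt \<real>"
    proof (rule islimptI)
      fix T :: "complex set" assume "1 \<in> T" "open T"
      then obtain e where e: "e > 0" "ball 1 e \<subseteq> T" by (meson openE)
      have "complex_of_real (1 + e / 2) \<in> ball 1 e"
        using e(1) by (simp add: dist_norm norm_divide)
      then show "\<exists>y\<in>\<real>. y \<in> T \<and> y \<noteq> 1"
        using e by (intro bexI[of _ "complex_of_real (1 + e / 2)"]) (auto simp del: of_real_add)
    qed
    then show "1 islimpt (\<real> - {0 :: complex})"
      using islimpt_insert[of 1 0 "\<real> - {0}"] by (auto simp: insert_absorb)
    show "?H z = 0" if "z \<in> \<real> - {0}" for z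
      using that zero by (auto elim!: Reals_cases)
  qed (use \<eta> in auto)
  then have "F (\<i> * of_real \<eta>) = G (\<i> * of_real \<eta>)" using \<eta> by simp
  also have "F (\<i> * of_real \<eta>) = (\<integral>\<omega>. of_real (exp (- \<eta> * X \<omega>)) \<partial>M)"
    unfolding F_def by (intro Bochner_Integration.integral_cong) (auto simp flip: exp_of_real mult.assoc)
  also have "\<dots> = of_real (\<integral>\<omega>. exp (- \<eta> * X \<omega>) \<partial>M)"
    by (rule integral_complex_of_real)
  also have "G (\<i> * of_real \<eta>) = of_real (exp (- t * \<eta> powr \<theta>))"
    using \<eta> by (simp add: G_def powr_of_real flip: exp_of_real mult.assoc)
  finally show ?thesis by (simp only: of_real_eq_iff)
qed

section \<open>Finite negative moments from the Laplace transform\<close>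

lemma powr_minus_le_suminf_exp:
  fixes s k :: real
  assumes s: "0 < s" and k: "0 < k"
  shows "ennreal (s powr (- k)) \<le> (\<Sum>n. ennreal (real (Suc n) powr k * exp 1 * exp (- real n * s)))"
proof -
  \<comment> \<open>A single term of the series suffices: 1 / s is at most n + 1, while n s is at
    most 1, so exp (1 - n s) is at least 1. Using n + 1 as the base also covers n = 0, that is s >
    1.\<close>
  define n where "n = nat \<lfloor>1 / s\<rfloor>"
  have "real n \<le> 1 / s"
    unfolding n_def using s by (intro of_nat_floor) simp
  then have ns: "real n * s \<le> 1"
    using s by (simp add: field_simps)
  have n_Suc: "1 / s \<le> real (Suc n)"
    unfolding n_def using real_of_int_floor_add_one_ge[of "1 / s"] s by (simp add: add.commute)
  have "s powr (- k) = (1 / s) powr k"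
    using s by (simp add: powr_minus_divide powr_divide)
  also have "\<dots> \<le> real (Suc n) powr k * 1"
    using n_Suc s k by (simp del: of_nat_Suc add: powr_mono2)
  also have "\<dots> \<le> real (Suc n) powr k * exp (1 - real n * s)"
    using ns by (intro mult_left_mono) auto
  also have "\<dots> = real (Suc n) powr k * exp 1 * exp (- real n * s)"
    by (simp add: exp_diff exp_minus divide_inverse)
  finally have "s powr (- k) \<le> real (Suc n) powr k * exp 1 * exp (- real n * s)" .
  moreover define f where "f n = real (Suc n) powr k * exp 1 * exp (- real n * s)" for n :: nat
  ultimately have "ennreal (s powr (- k)) \<le> (\<Sum>i\<in>{n}. ennreal (f i))"
    by (simp add: ennreal_leI)
  also have "\<dots> \<le> (\<Sum>n. ennreal (f n))"
    by (intro sum_le_suminf) auto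
  finally show ?thesis by (simp add: f_def)
qed

text \<open>The exponential series dominating X^(-k) is integrated term by term as a nonnegative
  series. Its terms are values of the Laplace transform at the natural numbers, and exp (- t
  n^theta) beats the polynomial weight (n + 1)^k.\<close>

lemma integrable_negative_moment:
  fixes X :: "'a \<Rightarrow> real"
  assumes "prob_space M" and [measurable]: "X \<in> borel_measurable M" and X: "AE \<omega> in M. 0 < X \<omega>"
    and laplace: "\<And>\<eta>. 0 \<le> \<eta> \<Longrightarrow> (\<integral>\<omega>. exp (- \<eta> * X \<omega>) \<partial>M) = exp (- t * \<eta> powr \<theta>)"
    and "0 < t" "0 < \<theta>" "0 < k"
  shows "integrable M (\<lambda>\<omega>. X \<omega> powr (- k))"
proof (rule integrableI_bounded)
  interpret prob_space M by fact
  have int: "integrable M (\<lambda>\<omega>. exp (- \<eta> * X \<omega>))" if "0 \<le> \<eta>" for \<eta>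
  proof (rule integrable_const_bound[where B = 1])
    show "AE \<omega> in M. norm (exp (- \<eta> * X \<omega>)) \<le> 1"
      using X by eventually_elim (use that in simp)
  qed measurable
  have "summable (\<lambda>n. real (Suc n) powr k * exp 1 * exp (- t * real n powr \<theta>))"
  proof (rule summable_comparison_test_ev)
    have "summable (\<lambda>n. real (Suc n) powr -2)"
      by (subst summable_Suc_iff) (simp add: summable_real_powr_iff)
    then show "summable (\<lambda>n. exp 1 * real (Suc n) powr -2)"
      by (rule summable_mult)
    \<comment> \<open>The extra 2 leaves room for comparison with the convergent series of (n +
      1)^(-2).\<close>
    have "filterlim (\<lambda>x. (k + 2) * ln (x + 1) - t * x powr \<theta>) at_bot at_top"
      using assms(5-7) by real_asymp
    then have "filterlim (\<lambda>n. (k + 2) * ln (real n + 1) - t * real n powr \<theta>) at_bot sequentially"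
      by (rule filterlim_compose) (rule filterlim_real_sequentially)
    then have "\<forall>\<^sub>F n in sequentially. (k + 2) * ln (real n + 1) - t * real n powr \<theta> \<le> 0"
      unfolding filterlim_at_bot by blast
    then show "\<forall>\<^sub>F n in sequentially. norm (real (Suc n) powr k * exp 1 * exp (- t * real n powr \<theta>))
        \<le> exp 1 * real (Suc n) powr -2"
    proof eventually_elim
      case (elim n)
      have "real (Suc n) powr k * exp (- t * real n powr \<theta>)
          = exp (k * ln (real n + 1) - t * real n powr \<theta>)"
        by (simp add: powr_def exp_diff exp_minus divide_inverse add.commute)
      also have "\<dots> \<le> exp (-2 * ln (real n + 1))"
        using elim by (simp add: algebra_simps)
      also have "\<dots> = real (Suc n) powr -2"
        by (simp add: powr_def add.commute)
      finally show ?case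
        by (simp add: abs_mult mult_ac del: of_nat_Suc)
    qed
  qed
  then have "(\<Sum>n. ennreal (real (Suc n) powr k * exp 1 * exp (- t * real n powr \<theta>))) \<noteq> \<top>"
    by (rule ennreal_suminf_neq_top) simp
  then have fin: "(\<Sum>n. ennreal (real (Suc n) powr k * exp 1 * exp (- t * real n powr \<theta>))) < \<infinity>"
    unfolding infinity_ennreal_def by (rule iffD1[OF less_top])
  have "(\<integral>\<^sup>+\<omega>. ennreal (norm (X \<omega> powr (- k))) \<partial>M)
      \<le> (\<integral>\<^sup>+\<omega>. (\<Sum>n. ennreal (real (Suc n) powr k * exp 1 * exp (- real n * X \<omega>))) \<partial>M)"
    using X by (intro nn_integral_mono_AE, eventually_elim) (use powr_minus_le_suminf_exp \<open>0 < k\<close> in auto)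
  also have "\<dots> = (\<Sum>n. \<integral>\<^sup>+\<omega>. ennreal (real (Suc n) powr k * exp 1 * exp (- real n * X \<omega>)) \<partial>M)"
    by (intro nn_integral_suminf) auto
  also have "\<dots> = (\<Sum>n. ennreal (real (Suc n) powr k * exp 1 * exp (- t * real n powr \<theta>)))"
  proof (intro suminf_cong)
    fix n
    have "(\<integral>\<^sup>+\<omega>. ennreal (real (Suc n) powr k * exp 1 * exp (- real n * X \<omega>)) \<partial>M)
        = ennreal (\<integral>\<omega>. real (Suc n) powr k * exp 1 * exp (- real n * X \<omega>) \<partial>M)"
      using int[of "real n"] by (intro nn_integral_eq_integral) auto
    also have "\<dots> = ennreal (real (Suc n) powr k * exp 1 * exp (- t * real n powr \<theta>))"
      using laplace[of "real n"] by simp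
    finally show "(\<integral>\<^sup>+\<omega>. ennreal (real (Suc n) powr k * exp 1 * exp (- real n * X \<omega>)) \<partial>M)
        = ennreal (real (Suc n) powr k * exp 1 * exp (- t * real n powr \<theta>))" .
  qed
  finally show "(\<integral>\<^sup>+\<omega>. ennreal (norm (X \<omega> powr (- k))) \<partial>M) < \<infinity>"
    using fin by (rule le_less_trans)
qed auto

subsection \<open>Density of the time-changed pseudoprocess\<close>

lemma damped_cos_integral_lim:
  fixes a w :: real
  assumes "0 < a"
  shows "((\<lambda>R. integral {0..R} (\<lambda>s. exp (- a * s) * cos (w * s))) \<longlongrightarrow> a / (a\<^sup>2 + w\<^sup>2)) at_top"
proof -
  \<comment> \<open>The real part of exp ((-a + i w) s) / (-a + i w), an antiderivative that
    vanishes at infinity.\<close>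
  define F where "F s = exp (- a * s) * (w * sin (w * s) - a * cos (w * s)) / (a\<^sup>2 + w\<^sup>2)" for s
  have pos: "0 < a\<^sup>2 + w\<^sup>2" using assms by (simp add: add_pos_nonneg)
  have "(F has_real_derivative exp (- a * s) * cos (w * s)) (at s within S)" for s S
  proof -
    have "(F has_real_derivative (exp (- a * s) * (w * (w * cos (w * s)) + a * (w * sin (w * s)))
        + - a * exp (- a * s) * (w * sin (w * s) - a * cos (w * s))) / (a\<^sup>2 + w\<^sup>2)) (at s within S)"
      unfolding F_def using pos by (auto intro!: derivative_eq_intros)
    moreover have "exp (- a * s) * (w * (w * cos (w * s)) + a * (w * sin (w * s)))
        + - a * exp (- a * s) * (w * sin (w * s) - a * cos (w * s))
        = exp (- a * s) * cos (w * s) * (a\<^sup>2 + w\<^sup>2)"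
      by (simp add: algebra_simps power2_eq_square)
    ultimately show ?thesis using pos assms by (simp add: sum_power2_eq_zero_iff split: if_splits)
  qed
  then have "integral {0..R} (\<lambda>s. exp (- a * s) * cos (w * s)) = F R - F 0" if "0 \<le> R" for R
    using that by (intro integral_unique fundamental_theorem_of_calculus)
      (auto simp: has_real_derivative_iff_has_vector_derivative)
  then have "\<forall>\<^sub>F R in at_top. F R - F 0 = integral {0..R} (\<lambda>s. exp (- a * s) * cos (w * s))"
    by (intro eventually_mono[OF eventually_ge_at_top[of 0]]) simp
  moreover have "((\<lambda>R. F R - F 0) \<longlongrightarrow> a / (a\<^sup>2 + w\<^sup>2)) at_top"
  proof -
    have "(F \<longlongrightarrow> 0) at_top"
    proof (rule Lim_null_comparison)
      show "((\<lambda>s. exp (- a * s) * (\<bar>w\<bar> + a) / (a\<^sup>2 + w\<^sup>2)) \<longlongrightarrow> 0) at_top"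
        using assms by real_asymp
      have "\<bar>w * sin (w * s) - a * cos (w * s)\<bar> \<le> \<bar>w\<bar> * 1 + a * 1" for s
        using assms by (intro order.trans[OF abs_triangle_ineq4] add_mono)
          (auto simp: abs_mult intro!: mult_left_le)
      then show "\<forall>\<^sub>F s in at_top. norm (F s) \<le> exp (- a * s) * (\<bar>w\<bar> + a) / (a\<^sup>2 + w\<^sup>2)"
        using pos by (intro always_eventually allI) (simp add: F_def abs_mult divide_right_mono)
    qed
    then have "((\<lambda>R. F R - F 0) \<longlongrightarrow> 0 - F 0) at_top" by (intro tendsto_intros)
    then show ?thesis by (simp add: F_def)
  qed
  ultimately show ?thesis by (rule Lim_transform_eventually[rotated])
qed

text \<open>The characteristic function is taken at g^alpha. The stable exponent 1 / alpha undoes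
  this power, so the exponent of the result is linear in g: the real part of exp (- t g exp (- i pi
  / (2 alpha))).\<close>

lemma expectation_cos_stable:
  assumes "prob_space M" and [measurable]: "X \<in> borel_measurable M" and "0 < \<alpha>" "0 \<le> g"
    and char: "\<And>\<gamma>. char (distr M borel X) \<gamma> =
      exp (- (of_real (t * \<bar>\<gamma>\<bar> powr (1 / \<alpha>)) * exp (- \<i> * of_real (pi * (1 / \<alpha>) / 2 * sgn \<gamma>))))"
  shows "(\<integral>\<omega>. cos (X \<omega> * g powr \<alpha>) \<partial>M)
    = exp (- (t * cos (pi / (2 * \<alpha>))) * g) * cos (t * sin (pi / (2 * \<alpha>)) * g)"
proof (cases "g = 0")
  case True
  interpret prob_space M by fact
  show ?thesis using True assms by (simp add: prob_space)
next
  case False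
  interpret prob_space M by fact
  define \<delta> where "\<delta> = pi / (2 * \<alpha>)"
  have "(\<integral>\<omega>. cos (X \<omega> * g powr \<alpha>) \<partial>M) = (\<integral>\<omega>. Re (exp (\<i> * of_real (g powr \<alpha> * X \<omega>))) \<partial>M)"
    by (simp add: Re_exp mult_ac)
  also have "\<dots> = Re (char (distr M borel X) (g powr \<alpha>))"
    unfolding char_def by (subst integral_distr) (auto intro!: integral_Re integrable_iexp)
  also have "char (distr M borel X) (g powr \<alpha>)
      = exp (- (of_real (t * g) * exp (- (\<i> * of_real \<delta>))))"
    unfolding char using False assms by (simp add: powr_powr \<delta>_def mult_ac)
  also have "exp (- (\<i> * of_real \<delta>)) = Complex (cos \<delta>) (- sin \<delta>)"
    by (simp add: complex_eq_iff Re_exp Im_exp)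
  also have "Re (exp (- (of_real (t * g) * Complex (cos \<delta>) (- sin \<delta>))))
      = exp (- (t * cos \<delta>) * g) * cos (t * sin \<delta> * g)"
    by (simp add: Re_exp mult_ac)
  finally show ?thesis by (simp add: \<delta>_def)
qed

text \<open>The sine products cancel in the sum. The Lebesgue form separates x from s, which serves
  both Fubini and measurability in s.\<close>

lemma osc_symmetrized:
  assumes "1 < \<alpha>"
  shows "osc \<alpha> x s R + osc \<alpha> (- x) s R
    = (LBINT g. indicator {0..R} g * (2 * (cos (g * x) * cos (s * g powr \<alpha>))))"
proof -
  have "osc \<alpha> x s R + osc \<alpha> (- x) s R
      = integral {0..R} (\<lambda>g. cos (g * x + s * g powr \<alpha>) + cos (g * (- x) + s * g powr \<alpha>))"
    unfolding osc_def using assms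
    by (intro Henstock_Kurzweil_Integration.integral_add[symmetric] integrable_continuous_real
        continuous_on_osc_integrand) auto
  also have "\<dots> = integral {0..R} (\<lambda>g. 2 * (cos (g * x) * cos (s * g powr \<alpha>)))"
    by (intro Henstock_Kurzweil_Integration.integral_cong) (simp add: cos_add cos_diff)
  also have "\<dots> = (LBINT g:{0..R}. 2 * (cos (g * x) * cos (s * g powr \<alpha>)))"
    using assms
    by (intro set_borel_integral_eq_integral(2)[symmetric] borel_integrable_atLeastAtMost')
      (auto intro!: continuous_intros continuous_on_powr')
  finally show ?thesis by (simp only: set_lebesgue_integral_def real_scaleR_def)
qed

text \<open>Truncation at \<open>R\<close> makes Fubini legitimate: the integrand is bounded by 2 on
  a product set of finite measure. The remaining product of two cosines splits into frequencies x +
  b and x - b, the source of the two Cauchy summands.\<close>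

lemma expectation_osc:
  assumes \<alpha>: "1 < \<alpha>" and M: "prob_space M" "X \<in> borel_measurable M"
    and char: "\<And>\<gamma>. char (distr M borel X) \<gamma> =
      exp (- (of_real (t * \<bar>\<gamma>\<bar> powr (1 / \<alpha>)) * exp (- \<i> * of_real (pi * (1 / \<alpha>) / 2 * sgn \<gamma>))))"
    and a: "a = t * cos (pi / (2 * \<alpha>))" and b: "b = t * sin (pi / (2 * \<alpha>))"
  shows "(\<integral>\<omega>. osc \<alpha> x (X \<omega>) R + osc \<alpha> (- x) (X \<omega>) R \<partial>M)
    = integral {0..R} (\<lambda>g. exp (- a * g) * cos ((x + b) * g))
    + integral {0..R} (\<lambda>g. exp (- a * g) * cos ((x - b) * g))"
proof -
  interpret prob_space M by fact
  interpret pair_sigma_finite M lborel ..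
  note [measurable] = M(2)
  let ?f = "\<lambda>\<omega> g. indicator {0..R} g * (2 * (cos (g * x) * cos (X \<omega> * g powr \<alpha>)))"
  have int: "integrable (M \<Otimes>\<^sub>M lborel) (case_prod ?f)"
  proof (rule integrableI_bounded_set[where A = "space M \<times> {0..R}" and B = 2])
    show "emeasure (M \<Otimes>\<^sub>M lborel) (space M \<times> {0..R}) < \<infinity>"
      by (simp add: lborel.emeasure_pair_measure_Times emeasure_space_1 emeasure_lborel_Icc_eq)
    have "\<bar>cos u * cos v\<bar> \<le> 1 * 1" for u v :: real
      unfolding abs_mult by (intro mult_mono) auto
    then show "AE z in M \<Otimes>\<^sub>M lborel. z \<in> space M \<times> {0..R} \<longrightarrow> norm (case_prod ?f z) \<le> 2"
      by (intro AE_I2) (auto simp: abs_mult)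
    show "AE z in M \<Otimes>\<^sub>M lborel. z \<notin> space M \<times> {0..R} \<longrightarrow> case_prod ?f z = 0"
      by (intro AE_I2) (auto simp: space_pair_measure indicator_def split: if_splits)
  qed measurable
  have "(\<integral>\<omega>. osc \<alpha> x (X \<omega>) R + osc \<alpha> (- x) (X \<omega>) R \<partial>M) = (\<integral>\<omega>. (LBINT g. ?f \<omega> g) \<partial>M)"
    using osc_symmetrized[OF \<alpha>] by simp
  also have "\<dots> = (LBINT g. (\<integral>\<omega>. ?f \<omega> g \<partial>M))"
    by (rule Fubini_integral[OF int, symmetric])
  also have "\<dots> = (LBINT g. indicator {0..R} g * (2 * (cos (g * x) * (exp (- a * g) * cos (b * g)))))"
  proof (intro Bochner_Integration.integral_cong refl)
    fix g :: real
    show "(\<integral>\<omega>. ?f \<omega> g \<partial>M) = indicator {0..R} g * (2 * (cos (g * x) * (exp (- a * g) * cos (b * g))))"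
      using expectation_cos_stable[OF M _ _ char, of g] \<alpha>
      by (cases "g \<in> {0..R}") (auto simp: a b)
  qed
  also have "\<dots> = (LBINT g:{0..R}. exp (- a * g) * cos ((x + b) * g) + exp (- a * g) * cos ((x - b) * g))"
    by (simp add: set_lebesgue_integral_def cos_add cos_diff algebra_simps)
  also have "\<dots> = integral {0..R} (\<lambda>g. exp (- a * g) * cos ((x + b) * g) + exp (- a * g) * cos ((x - b) * g))"
    by (intro set_borel_integral_eq_integral(2) borel_integrable_atLeastAtMost' continuous_intros)
  also have "\<dots> = integral {0..R} (\<lambda>g. exp (- a * g) * cos ((x + b) * g))
    + integral {0..R} (\<lambda>g. exp (- a * g) * cos ((x - b) * g))"
    by (intro Henstock_Kurzweil_Integration.integral_add integrable_continuous_real continuous_intros)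
  finally show ?thesis .
qed

text \<open>The expectation of the truncated integrals has two limits that must coincide: one by
  dominated convergence, the other from the explicit damped cosine integrals. The point x = 0 is
  excluded because the dominating function contains 2 / |x|.\<close>

lemma subordinated_fresnel_density_eq:
  assumes \<alpha>: "1 < \<alpha>" and S: "stable_subordinator M (1 / \<alpha>) S" and p: "has_pos_density M (S t) p"
    and t: "0 < t" and x: "x \<noteq> 0"
  shows "(LINT s:{0<..}|lborel. fresnel_density \<alpha> x s * p s) = cauchy_mixture_density \<alpha> t x"
proof -
  define X where "X = S t"
  have M: "prob_space M" "X \<in> borel_measurable M" "AE \<omega> in M. 0 < X \<omega>"
    and char: "\<And>\<gamma>. char (distr M borel X) \<gamma> =
      exp (- (of_real (t * \<bar>\<gamma>\<bar> powr (1 / \<alpha>)) * exp (- \<i> * of_real (pi * (1 / \<alpha>) / 2 * sgn \<gamma>))))"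
    using S t by (auto simp: stable_subordinator_def X_def)
  interpret prob_space M by fact
  note [measurable] = M(2)
  define q where "q s = indicator {0<..} s * p s" for s
  have q: "distributed M lborel X (\<lambda>s. ennreal (q s))" "\<And>s. 0 \<le> q s"
    using p by (auto simp: has_pos_density_def X_def q_def indicator_def)
  define u where "u s = indicator {0<..} s * fresnel_density \<alpha> x s" for s
  have u_lim: "((\<lambda>R. indicator {0<..} s * ((osc \<alpha> x s R + osc \<alpha> (- x) s R) / (2 * pi))) \<longlongrightarrow> u s) at_top" for s
    using fresnel_density_lim[OF \<alpha>, of s x] by (cases "s > 0") (auto simp: u_def)
  have osc_meas [measurable]: "(\<lambda>s. osc \<alpha> x s R + osc \<alpha> (- x) s R) \<in> borel_measurable borel" for R
    unfolding osc_symmetrized[OF \<alpha>] by measurable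
  \<comment> \<open>Measurability in the time variable comes from writing \<open>u\<close> as a
    pointwise limit of truncated integrals along the integers.\<close>
  have u_meas [measurable]: "u \<in> borel_measurable borel"
  proof (rule borel_measurable_LIMSEQ_real)
    show "(\<lambda>n. indicator {0<..} s * ((osc \<alpha> x s (real n) + osc \<alpha> (- x) s (real n)) / (2 * pi))) \<longlonglongrightarrow> u s" for s
      using filterlim_compose[OF u_lim filterlim_real_sequentially] .
  qed measurable
  have "(LINT s:{0<..}|lborel. fresnel_density \<alpha> x s * p s) = (LBINT s. q s * u s)"
    unfolding set_lebesgue_integral_def
    by (intro Bochner_Integration.integral_cong) (auto simp: q_def u_def indicator_def)
  also have "\<dots> = (\<integral>\<omega>. u (X \<omega>) \<partial>M)"
    using q by (intro distributed_integral) auto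
  finally have lhs: "(LINT s:{0<..}|lborel. fresnel_density \<alpha> x s * p s) = (\<integral>\<omega>. u (X \<omega>) \<partial>M)" .

  define k where "k = 1 / (\<alpha> - 1)"
  define C where "C = (2 * \<bar>x\<bar> / \<alpha>) powr k"
  have moment: "integrable M (\<lambda>\<omega>. X \<omega> powr (- k))"
    using \<alpha> t laplace_transform_stable[OF M _ char]
    by (intro integrable_negative_moment[OF M, where t = t and \<theta> = "1 / \<alpha>"]) (auto simp: k_def)
  have lim: "((\<lambda>R. \<integral>\<omega>. (osc \<alpha> x (X \<omega>) R + osc \<alpha> (- x) (X \<omega>) R) / (2 * pi) \<partial>M) \<longlongrightarrow> (\<integral>\<omega>. u (X \<omega>) \<partial>M)) at_top"
  proof (rule integral_dominated_convergence_at_top)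
    show "integrable M (\<lambda>\<omega>. (C * X \<omega> powr (- k) + 2 / \<bar>x\<bar>) / pi)"
      using moment by (auto intro!: Bochner_Integration.integrable_add)
    show "AE \<omega> in M. ((\<lambda>R. (osc \<alpha> x (X \<omega>) R + osc \<alpha> (- x) (X \<omega>) R) / (2 * pi)) \<longlongrightarrow> u (X \<omega>)) at_top"
      using M(3)
    proof eventually_elim
      case (elim \<omega>)
      then show ?case using u_lim[of "X \<omega>"] by simp
    qed
    show "\<forall>\<^sub>F R in at_top. AE \<omega> in M. norm ((osc \<alpha> x (X \<omega>) R + osc \<alpha> (- x) (X \<omega>) R) / (2 * pi))
        \<le> (C * X \<omega> powr (- k) + 2 / \<bar>x\<bar>) / pi"
      using eventually_ge_at_top[of 0]
    proof eventually_elim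
      case (elim R)
      show ?case using M(3)
      proof eventually_elim
        case (elim \<omega>)
        have "\<bar>osc \<alpha> x (X \<omega>) R + osc \<alpha> (- x) (X \<omega>) R\<bar> \<le> 2 * (C * X \<omega> powr (- k) + 2 / \<bar>x\<bar>)"
          using osc_bound[OF \<alpha> elim, of x R] osc_bound[OF \<alpha> elim, of "- x" R] x \<open>0 \<le> R\<close>
          unfolding C_def k_def by auto
        then show ?case by (simp add: field_simps)
      qed
    qed
  qed measurable
  define a where "a = t * cos (pi / (2 * \<alpha>))"
  define b where "b = t * sin (pi / (2 * \<alpha>))"
  have "0 < a" using \<alpha> t unfolding a_def by (intro mult_pos_pos cos_gt_zero) (auto simp: field_simps)
  note osc_expectation = expectation_osc[OF \<alpha> M(1,2) char a_def b_def]
  have "((\<lambda>R. \<integral>\<omega>. (osc \<alpha> x (X \<omega>) R + osc \<alpha> (- x) (X \<omega>) R) / (2 * pi) \<partial>M) \<longlongrightarrow>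
      (a / (a\<^sup>2 + (x + b)\<^sup>2) + a / (a\<^sup>2 + (x - b)\<^sup>2)) / (2 * pi)) at_top"
    using \<open>0 < a\<close> unfolding integral_divide_zero osc_expectation
    by (intro tendsto_intros damped_cos_integral_lim) auto
  then have "(\<integral>\<omega>. u (X \<omega>) \<partial>M) = (a / (a\<^sup>2 + (x + b)\<^sup>2) + a / (a\<^sup>2 + (x - b)\<^sup>2)) / (2 * pi)"
    using lim by (intro tendsto_unique[OF _ lim]) auto
  \<comment> \<open>Here a^2 + b^2 = t^2.\<close>
  also have "a\<^sup>2 + (x + b)\<^sup>2 = x\<^sup>2 + t\<^sup>2 + 2 * x * t * sin (pi / (2 * \<alpha>))"
    unfolding a_def b_def using sin_cos_squared_add[of "pi / (2 * \<alpha>)"] by algebra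
  also have "a\<^sup>2 + (x - b)\<^sup>2 = x\<^sup>2 + t\<^sup>2 - 2 * x * t * sin (pi / (2 * \<alpha>))"
    unfolding a_def b_def using sin_cos_squared_add[of "pi / (2 * \<alpha>)"] by algebra
  finally show ?thesis
    unfolding lhs by (simp only: cauchy_mixture_density_def a_def) (simp add: add.commute)
qed

subsection \<open>Shape of the mixture of Cauchy densities\<close>

context
  fixes \<alpha> t :: real
  assumes \<alpha>: "1 < \<alpha>" and t: "0 < t"
begin

lemma angle_bounds: "0 < pi / (2 * \<alpha>)" "pi / (2 * \<alpha>) < pi / 2"
  using \<alpha> by (auto simp: field_simps)

lemma sin_angle_pos: "0 < sin (pi / (2 * \<alpha>))"
  using angle_bounds by (intro sin_gt_zero) linarith+

lemma cos_angle_pos: "0 < cos (pi / (2 * \<alpha>))"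
  using angle_bounds by (intro cos_gt_zero) auto

lemma sin_angle_gt_half_iff: "1 / 2 < sin (pi / (2 * \<alpha>)) \<longleftrightarrow> \<alpha> < 3"
proof -
  have "1 / 2 < sin (pi / (2 * \<alpha>)) \<longleftrightarrow> sin (pi / 6) < sin (pi / (2 * \<alpha>))"
    by (simp add: sin_30)
  also have "\<dots> \<longleftrightarrow> pi / 6 < pi / (2 * \<alpha>)"
    using angle_bounds by (intro sin_mono_less_eq) auto
  also have "\<dots> \<longleftrightarrow> \<alpha> < 3"
    using \<alpha> by (simp add: field_simps)
  finally show ?thesis .
qed

lemma cos_double_angle: "cos (pi / \<alpha>) = 1 - 2 * (sin (pi / (2 * \<alpha>)))\<^sup>2"
  using cos_double_sin[of "pi / (2 * \<alpha>)"] by simp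

lemma shifted_square_pos:
  "0 < x\<^sup>2 + t\<^sup>2 - 2 * x * t * sin (pi / (2 * \<alpha>))" "0 < x\<^sup>2 + t\<^sup>2 + 2 * x * t * sin (pi / (2 * \<alpha>))"
proof -
  have "0 < (x - t * sin (pi / (2 * \<alpha>)))\<^sup>2 + (t * cos (pi / (2 * \<alpha>)))\<^sup>2" for x
    using t cos_angle_pos by (simp add: add_nonneg_pos)
  moreover have "(x - t * sin (pi / (2 * \<alpha>)))\<^sup>2 + (t * cos (pi / (2 * \<alpha>)))\<^sup>2
      = x\<^sup>2 + t\<^sup>2 - 2 * x * t * sin (pi / (2 * \<alpha>))" for x
    using sin_cos_squared_add[of "pi / (2 * \<alpha>)"] by algebra
  ultimately have *: "0 < x\<^sup>2 + t\<^sup>2 - 2 * x * t * sin (pi / (2 * \<alpha>))" for x by simp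
  show "0 < x\<^sup>2 + t\<^sup>2 - 2 * x * t * sin (pi / (2 * \<alpha>))" "0 < x\<^sup>2 + t\<^sup>2 + 2 * x * t * sin (pi / (2 * \<alpha>))"
    using *[of x] *[of "- x"] by auto
qed

text \<open>With the double angle formula the quartic is the difference of squares (x^2 + t^2)^2 -
  (2 x t sin (pi / (2 alpha)))^2.\<close>

lemma quartic_factorization:
  "x ^ 4 + t ^ 4 + 2 * x\<^sup>2 * t\<^sup>2 * cos (pi / \<alpha>)
    = (x\<^sup>2 + t\<^sup>2 - 2 * x * t * sin (pi / (2 * \<alpha>))) * (x\<^sup>2 + t\<^sup>2 + 2 * x * t * sin (pi / (2 * \<alpha>)))"
proof -
  have "x ^ 4 + t ^ 4 + 2 * x\<^sup>2 * t\<^sup>2 * (1 - 2 * s\<^sup>2)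
      = (x\<^sup>2 + t\<^sup>2 - 2 * x * t * s) * (x\<^sup>2 + t\<^sup>2 + 2 * x * t * s)" for s :: real
    by (simp add: power2_eq_square power4_eq_xxxx algebra_simps)
  then show ?thesis unfolding cos_double_angle .
qed

lemma quartic_pos: "0 < x ^ 4 + t ^ 4 + 2 * x\<^sup>2 * t\<^sup>2 * cos (pi / \<alpha>)"
  unfolding quartic_factorization using shifted_square_pos by (rule mult_pos_pos)

lemma cauchy_mixture_density_eq:
  "cauchy_mixture_density \<alpha> t x = t * cos (pi / (2 * \<alpha>)) / pi *
     ((x\<^sup>2 + t\<^sup>2) / (x ^ 4 + t ^ 4 + 2 * x\<^sup>2 * t\<^sup>2 * cos (pi / \<alpha>)))"
proof -
  have sum_inverse: "1 / (2 * pi) * (c / P + c / Q) = c / pi * (u / (P * Q))"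
    if "0 < P" "0 < Q" "P + Q = 2 * u" for P Q u c :: real
  proof -
    have "c / P + c / Q = c * (P + Q) / (P * Q)" using that(1,2) by (simp add: field_simps)
    then show ?thesis using that by simp
  qed
  show ?thesis
    unfolding quartic_factorization cauchy_mixture_density_def
    by (rule sum_inverse) (use shifted_square_pos in auto)
qed

lemma cauchy_mixture_density_pos: "0 < cauchy_mixture_density \<alpha> t x"
proof -
  have "0 < x\<^sup>2 + t\<^sup>2" using t by (intro add_nonneg_pos) auto
  then show ?thesis
    unfolding cauchy_mixture_density_eq using t cos_angle_pos quartic_pos[of x]
    by (intro mult_pos_pos divide_pos_pos pi_gt_zero)
qed

text \<open>Put A = x^2 + t^2 and c = 2 t^2 sin (pi / (2 alpha)). Up to a positive factor, 1 / f is
  A + c^2 / A minus a constant, so f depends only on A and grows as A approaches c.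
  Cross-multiplication turns this into a polynomial sign condition that settles all global
  comparisons without calculus.\<close>

lemma cauchy_mixture_density_le_iff:
  "cauchy_mixture_density \<alpha> t x \<le> cauchy_mixture_density \<alpha> t y \<longleftrightarrow>
     (x\<^sup>2 - y\<^sup>2) * ((2 * t\<^sup>2 * sin (pi / (2 * \<alpha>)))\<^sup>2 - (x\<^sup>2 + t\<^sup>2) * (y\<^sup>2 + t\<^sup>2)) \<le> 0"
proof -
  let ?D = "\<lambda>x. x ^ 4 + t ^ 4 + 2 * x\<^sup>2 * t\<^sup>2 * cos (pi / \<alpha>)"
  have K: "0 < t * cos (pi / (2 * \<alpha>)) / pi" using t cos_angle_pos by simp
  have "cauchy_mixture_density \<alpha> t x \<le> cauchy_mixture_density \<alpha> t y
      \<longleftrightarrow> (x\<^sup>2 + t\<^sup>2) / ?D x \<le> (y\<^sup>2 + t\<^sup>2) / ?D y"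
    unfolding cauchy_mixture_density_eq by (rule mult_le_cancel_left_pos[OF K])
  also have "\<dots> \<longleftrightarrow> (x\<^sup>2 + t\<^sup>2) * ?D y \<le> (y\<^sup>2 + t\<^sup>2) * ?D x"
    using quartic_pos[of x] quartic_pos[of y] by (simp add: divide_le_eq pos_le_divide_eq mult_ac)
  also have "\<dots> \<longleftrightarrow> (x\<^sup>2 + t\<^sup>2) * ?D y - (y\<^sup>2 + t\<^sup>2) * ?D x \<le> 0"
    by simp
  also have "(x\<^sup>2 + t\<^sup>2) * ?D y - (y\<^sup>2 + t\<^sup>2) * ?D x
      = (x\<^sup>2 - y\<^sup>2) * ((2 * t\<^sup>2 * sin (pi / (2 * \<alpha>)))\<^sup>2 - (x\<^sup>2 + t\<^sup>2) * (y\<^sup>2 + t\<^sup>2))"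
    unfolding cos_double_angle by algebra
  finally show ?thesis .
qed

lemma cauchy_mixture_density_deriv:
  "(cauchy_mixture_density \<alpha> t has_real_derivative
     t * cos (pi / (2 * \<alpha>)) / pi * (2 * x * ((2 * t\<^sup>2 * sin (pi / (2 * \<alpha>)))\<^sup>2 - (x\<^sup>2 + t\<^sup>2)\<^sup>2) /
       (x ^ 4 + t ^ 4 + 2 * x\<^sup>2 * t\<^sup>2 * cos (pi / \<alpha>))\<^sup>2)) (at x)"
proof -
  let ?D = "\<lambda>x. x ^ 4 + t ^ 4 + 2 * x\<^sup>2 * t\<^sup>2 * cos (pi / \<alpha>)"
  have num: "((\<lambda>x. x\<^sup>2 + t\<^sup>2) has_real_derivative 2 * x) (at x)"
    by (auto intro!: derivative_eq_intros)
  have den: "(?D has_real_derivative 4 * x ^ 3 + 4 * x * t\<^sup>2 * cos (pi / \<alpha>)) (at x)"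
    by (auto intro!: derivative_eq_intros)
  have "((\<lambda>x. (x\<^sup>2 + t\<^sup>2) / ?D x) has_real_derivative
      (2 * x * ?D x - (x\<^sup>2 + t\<^sup>2) * (4 * x ^ 3 + 4 * x * t\<^sup>2 * cos (pi / \<alpha>))) / (?D x * ?D x)) (at x)"
    using DERIV_divide[OF num den] quartic_pos[of x] by simp
  also have "2 * x * ?D x - (x\<^sup>2 + t\<^sup>2) * (4 * x ^ 3 + 4 * x * t\<^sup>2 * cos (pi / \<alpha>))
      = 2 * x * ((2 * t\<^sup>2 * sin (pi / (2 * \<alpha>)))\<^sup>2 - (x\<^sup>2 + t\<^sup>2)\<^sup>2)"
    unfolding cos_double_angle by algebra
  finally show ?thesis
    unfolding cauchy_mixture_density_eq[abs_def] power2_eq_square[of "?D x"]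
    by (rule DERIV_cmult)
qed

lemma cauchy_mixture_density_field_differentiable: "cauchy_mixture_density \<alpha> t field_differentiable at x"
  unfolding field_differentiable_def using cauchy_mixture_density_deriv by blast

lemma deriv_cauchy_mixture_density_eq_0_iff:
  "deriv (cauchy_mixture_density \<alpha> t) x = 0 \<longleftrightarrow> x = 0 \<or> x\<^sup>2 = t\<^sup>2 * (2 * sin (pi / (2 * \<alpha>)) - 1)"
proof -
  have "deriv (cauchy_mixture_density \<alpha> t) x = 0
      \<longleftrightarrow> x = 0 \<or> (2 * t\<^sup>2 * sin (pi / (2 * \<alpha>)))\<^sup>2 - (x\<^sup>2 + t\<^sup>2)\<^sup>2 = 0"
    unfolding DERIV_imp_deriv[OF cauchy_mixture_density_deriv]
    using t cos_angle_pos quartic_pos[of x] by simp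
  also have "(2 * t\<^sup>2 * sin (pi / (2 * \<alpha>)))\<^sup>2 - (x\<^sup>2 + t\<^sup>2)\<^sup>2 = 0
      \<longleftrightarrow> (2 * t\<^sup>2 * sin (pi / (2 * \<alpha>)))\<^sup>2 = (x\<^sup>2 + t\<^sup>2)\<^sup>2"
    by simp
  also have "\<dots> \<longleftrightarrow> 2 * t\<^sup>2 * sin (pi / (2 * \<alpha>)) = x\<^sup>2 + t\<^sup>2"
    using sin_angle_pos by (intro power2_eq_iff_nonneg) auto
  also have "\<dots> \<longleftrightarrow> x\<^sup>2 = t\<^sup>2 * (2 * sin (pi / (2 * \<alpha>)) - 1)"
    by (auto simp: algebra_simps)
  finally show ?thesis .
qed

text \<open>Fermat's rule, leaving only the critical points as candidates for modes.\<close>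

lemma modes_subset_critical: "modes (cauchy_mixture_density \<alpha> t) \<subseteq> {x. deriv (cauchy_mixture_density \<alpha> t) x = 0}"
proof clarify
  fix x assume "x \<in> modes (cauchy_mixture_density \<alpha> t)"
  then obtain d where d: "0 < d"
    "\<And>y. dist y x < d \<Longrightarrow> cauchy_mixture_density \<alpha> t y \<le> cauchy_mixture_density \<alpha> t x"
    by (auto simp: modes_def is_local_max_def eventually_nhds_metric)
  have "deriv (cauchy_mixture_density \<alpha> t) x
      = t * cos (pi / (2 * \<alpha>)) / pi * (2 * x * ((2 * t\<^sup>2 * sin (pi / (2 * \<alpha>)))\<^sup>2 - (x\<^sup>2 + t\<^sup>2)\<^sup>2) /
       (x ^ 4 + t ^ 4 + 2 * x\<^sup>2 * t\<^sup>2 * cos (pi / \<alpha>))\<^sup>2)"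
    by (rule DERIV_imp_deriv[OF cauchy_mixture_density_deriv])
  also have "\<dots> = 0"
    using d by (intro DERIV_local_max[OF cauchy_mixture_density_deriv d(1)]) (auto simp: dist_real_def)
  finally show "deriv (cauchy_mixture_density \<alpha> t) x = 0" .
qed

lemma cauchy_mixture_bimodal:
  assumes "\<alpha> < 3"
  defines "f \<equiv> cauchy_mixture_density \<alpha> t" and "m \<equiv> t * sqrt (2 * sin (pi / (2 * \<alpha>)) - 1)"
  shows "{x. deriv f x = 0} = {0, m, - m}" "card {x. deriv f x = 0} = 3" "bimodal f"
    "modes f = {m, - m}" "f x \<le> f m" "f x \<le> f (- m)" "is_local_min f 0"
proof -
  have half: "1 / 2 < sin (pi / (2 * \<alpha>))"
    using sin_angle_gt_half_iff assms by simp
  have m: "0 < m" "m\<^sup>2 = t\<^sup>2 * (2 * sin (pi / (2 * \<alpha>)) - 1)"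
    using t half by (auto simp: m_def power_mult_distrib)
  show crit: "{x. deriv f x = 0} = {0, m, - m}"
    unfolding f_def deriv_cauchy_mixture_density_eq_0_iff m(2)[symmetric] power2_eq_iff by auto
  show "card {x. deriv f x = 0} = 3"
    unfolding crit using m by simp
  have max_m: "f x \<le> f y" if "y\<^sup>2 = m\<^sup>2" for x y
  proof -
    \<comment> \<open>At both outer critical points the constant of the comparison criterion equals
      y^2 + t^2, which makes the criterion minus a square times a positive factor.\<close>
    have y: "2 * t\<^sup>2 * sin (pi / (2 * \<alpha>)) = y\<^sup>2 + t\<^sup>2"
      unfolding that m(2) by (simp add: algebra_simps)
    have "(x\<^sup>2 - y\<^sup>2) * ((y\<^sup>2 + t\<^sup>2)\<^sup>2 - (x\<^sup>2 + t\<^sup>2) * (y\<^sup>2 + t\<^sup>2)) = - ((y\<^sup>2 + t\<^sup>2) * (x\<^sup>2 - y\<^sup>2)\<^sup>2)"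
      by algebra
    then show ?thesis
      unfolding f_def cauchy_mixture_density_le_iff y by simp
  qed
  show "f x \<le> f m" "f x \<le> f (- m)" by (simp_all add: max_m)
  \<comment> \<open>The value of x^2 at which the density returns to its value at 0; for smaller
    nonzero x it is strictly larger.\<close>
  define r where "r = t\<^sup>2 * ((2 * sin (pi / (2 * \<alpha>)))\<^sup>2 - 1)"
  have "1 < (2 * sin (pi / (2 * \<alpha>)))\<^sup>2"
    using half by (intro one_less_power) auto
  then have r: "0 < r" using t by (simp add: r_def)
  have factor: "(2 * t\<^sup>2 * sin (pi / (2 * \<alpha>)))\<^sup>2 - (x\<^sup>2 + t\<^sup>2) * (0\<^sup>2 + t\<^sup>2) = t\<^sup>2 * (r - x\<^sup>2)" for x
    unfolding r_def by (simp add: power2_eq_square algebra_simps)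
  have near: "\<forall>\<^sub>F x in nhds 0. x\<^sup>2 < r"
  proof -
    have "((\<lambda>x. x\<^sup>2) \<longlongrightarrow> 0\<^sup>2) (nhds (0::real))" by (intro tendsto_power filterlim_ident)
    then show ?thesis using r by (intro order_tendstoD(2)) auto
  qed
  show "is_local_min f 0"
    unfolding is_local_min_def using near
  proof eventually_elim
    case (elim x)
    have "(0\<^sup>2 - x\<^sup>2) * (t\<^sup>2 * (r - x\<^sup>2)) \<le> 0"
      using elim by (intro mult_nonpos_nonneg) auto
    then show ?case
      unfolding f_def cauchy_mixture_density_le_iff mult.commute[of "0\<^sup>2 + t\<^sup>2"] factor .
  qed
  \<comment> \<open>Modes are defined by a weak inequality, so being a local minimum does not
    exclude 0; a strict increase at nearby points does.\<close>
  have "\<not> is_local_max f 0"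
  proof
    assume "is_local_max f 0"
    then have "\<forall>\<^sub>F x in nhds 0. f x \<le> f 0 \<and> x\<^sup>2 < r"
      using near unfolding is_local_max_def by (rule eventually_conj)
    then have "\<forall>\<^sub>F x in at 0. f x \<le> f 0 \<and> x\<^sup>2 < r \<and> x \<noteq> 0"
      by (auto simp: eventually_at_filter elim: eventually_mono)
    then obtain x where x: "f x \<le> f 0" "x\<^sup>2 < r" "x \<noteq> 0"
      using eventually_happens[of _ "at (0::real)"] by auto
    have "(x\<^sup>2 - 0\<^sup>2) * (t\<^sup>2 * (r - x\<^sup>2)) \<le> 0"
      using x(1) unfolding f_def cauchy_mixture_density_le_iff factor .
    moreover have "0 < (x\<^sup>2 - 0\<^sup>2) * (t\<^sup>2 * (r - x\<^sup>2))"
      using x t by simp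
    ultimately show False by linarith
  qed
  moreover have "modes f \<subseteq> {0, m, - m}"
    using modes_subset_critical unfolding f_def[symmetric] crit .
  moreover have "is_local_max f m" "is_local_max f (- m)"
    by (auto simp: is_local_max_def max_m)
  ultimately show modes: "modes f = {m, - m}"
    by (auto simp: modes_def)
  show "bimodal f"
    unfolding bimodal_def modes using m by simp
qed

text \<open>Once the sine is at most 1/2, the radius \<open>r\<close> of the bimodal case is
  nonpositive and comparison with 0 has the same sign for every x. At alpha = 3 the outer critical
  points merge into 0.\<close>

lemma cauchy_mixture_unimodal:
  assumes "3 \<le> \<alpha>"
  defines "f \<equiv> cauchy_mixture_density \<alpha> t"
  shows "{x. deriv f x = 0} = {0}" "unimodal f" "modes f = {0}" "f x \<le> f 0"
proof -
  have half: "sin (pi / (2 * \<alpha>)) \<le> 1 / 2"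
    using sin_angle_gt_half_iff assms by linarith
  have "x = 0" if "x\<^sup>2 = t\<^sup>2 * (2 * sin (pi / (2 * \<alpha>)) - 1)" for x
  proof -
    have "t\<^sup>2 * (2 * sin (pi / (2 * \<alpha>)) - 1) \<le> 0"
      using half by (intro mult_nonneg_nonpos) auto
    then have "x\<^sup>2 \<le> 0" unfolding that .
    then show ?thesis by simp
  qed
  then show crit: "{x. deriv f x = 0} = {0}"
    unfolding f_def deriv_cauchy_mixture_density_eq_0_iff by auto
  have max: "f x \<le> f 0" for x
  proof -
    have "(2 * sin (pi / (2 * \<alpha>)))\<^sup>2 \<le> 1"
      using half sin_angle_pos by (intro power_le_one) auto
    then have "t\<^sup>2 * ((2 * sin (pi / (2 * \<alpha>)))\<^sup>2 - 1) \<le> 0"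
      by (intro mult_nonneg_nonpos) auto
    then have "(x\<^sup>2 - 0\<^sup>2) * (t\<^sup>2 * (t\<^sup>2 * ((2 * sin (pi / (2 * \<alpha>)))\<^sup>2 - 1) - x\<^sup>2)) \<le> 0"
      by (intro mult_nonneg_nonpos) (auto intro: order_trans[OF _ zero_le_power2])
    also have "t\<^sup>2 * (t\<^sup>2 * ((2 * sin (pi / (2 * \<alpha>)))\<^sup>2 - 1) - x\<^sup>2)
        = (2 * t\<^sup>2 * sin (pi / (2 * \<alpha>)))\<^sup>2 - (x\<^sup>2 + t\<^sup>2) * (0\<^sup>2 + t\<^sup>2)"
      by (simp add: power2_eq_square algebra_simps)
    finally show ?thesis unfolding f_def cauchy_mixture_density_le_iff .
  qed
  then show "f x \<le> f 0" .
  show modes: "modes f = {0}"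
    using modes_subset_critical max unfolding f_def[symmetric] crit
    by (auto simp: modes_def is_local_max_def)
  show "unimodal f"
    unfolding unimodal_def modes by simp
qed

section \<open>Continuity and total mass of the mixture\<close>

lemma continuous_on_cauchy_mixture_density: "continuous_on S (cauchy_mixture_density \<alpha> t)"
  using cauchy_mixture_density_deriv by (intro DERIV_continuous_on) (auto intro: DERIV_subset)

lemma prob_space_cauchy_mixture:
  "prob_space (density lborel (\<lambda>x. ennreal (cauchy_mixture_density \<alpha> t x)))"
proof -
  let ?f = "cauchy_mixture_density \<alpha> t"
  define a where "a = t * cos (pi / (2 * \<alpha>))"
  define b where "b = t * sin (pi / (2 * \<alpha>))"
  have a: "0 < a" using t cos_angle_pos by (simp add: a_def)
  \<comment> \<open>The distribution function shifted down by 1/2: its limits are 1/2 and -1/2, so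
    the total mass is 1.\<close>
  define F where "F x = (arctan ((x - b) / a) + arctan ((x + b) / a)) / (2 * pi)" for x
  have sq: "a\<^sup>2 + (x - b)\<^sup>2 = x\<^sup>2 + t\<^sup>2 - 2 * x * t * sin (pi / (2 * \<alpha>))"
    "a\<^sup>2 + (x + b)\<^sup>2 = x\<^sup>2 + t\<^sup>2 + 2 * x * t * sin (pi / (2 * \<alpha>))" for x
    unfolding a_def b_def using sin_cos_squared_add[of "pi / (2 * \<alpha>)"] by algebra+
  have arctan: "((\<lambda>x. arctan ((x + c) / a)) has_real_derivative a / (a\<^sup>2 + (x + c)\<^sup>2)) (at x)" for x c
  proof -
    have "((\<lambda>x. arctan ((x + c) / a)) has_real_derivative inverse (1 + ((x + c) / a)\<^sup>2) * (1 / a)) (at x)"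
      using a by (auto intro!: derivative_eq_intros)
    also have "inverse (1 + ((x + c) / a)\<^sup>2) * (1 / a) = a / (a\<^sup>2 + (x + c)\<^sup>2)"
      using a by (simp add: divide_simps power2_eq_square)
    finally show ?thesis .
  qed
  have F: "(F has_real_derivative ?f x) (at x)" for x
  proof -
    have "(F has_real_derivative (a / (a\<^sup>2 + (x - b)\<^sup>2) + a / (a\<^sup>2 + (x + b)\<^sup>2)) / (2 * pi)) (at x)"
      unfolding F_def using arctan[of "- b" x] arctan[of b x]
      by (intro DERIV_cdivide DERIV_add) simp_all
    then show ?thesis
      unfolding sq by (simp add: cauchy_mixture_density_def a_def)
  qed
  have "(F \<longlongrightarrow> 1 / 2) at_top" "(F \<longlongrightarrow> - 1 / 2) at_bot"
    unfolding F_def using a by (real_asymp, real_asymp)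
  then have lims: "((F \<circ> real_of_ereal) \<longlongrightarrow> 1 / 2) (at_left \<infinity>)" "((F \<circ> real_of_ereal) \<longlongrightarrow> - 1 / 2) (at_right (- \<infinity>))"
    by (simp_all add: ereal_tendsto_simps)
  have cont: "isCont ?f x" for x
    by (rule DERIV_isCont[OF cauchy_mixture_density_deriv])
  have int: "integrable lborel ?f"
    using interval_integral_FTC_nonneg(1)[OF _ F cont _ lims(2,1)] less_imp_le[OF cauchy_mixture_density_pos]
    by (simp add: set_integrable_def)
  have "(LBINT x. ?f x) = 1"
    using interval_integral_FTC_nonneg(2)[OF _ F cont _ lims(2,1)] less_imp_le[OF cauchy_mixture_density_pos]
    by (simp add: interval_lebesgue_integral_def set_lebesgue_integral_def)
  then have "(\<integral>\<^sup>+x. ennreal (?f x) \<partial>lborel) = 1"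
    using nn_integral_eq_integral[OF int] less_imp_le[OF cauchy_mixture_density_pos] by simp
  then show ?thesis
    using int by (intro prob_spaceI) (simp add: emeasure_density)
qed

end

section \<open>Identification of the distribution and conclusion\<close>

lemma subordinated_fresnel_has_prob_density:
  assumes \<alpha>: "1 < \<alpha>" and S: "stable_subordinator M (1 / \<alpha>) S" and p: "has_pos_density M (S t) p"
    and t: "0 < t"
  shows "has_prob_density (subordinated_fresnel_distribution \<alpha> p) (cauchy_mixture_density \<alpha> t)"
  unfolding has_prob_density_def
proof (intro conjI allI ballI)
  let ?f = "cauchy_mixture_density \<alpha> t"
  let ?g = "\<lambda>x. LINT s:{0<..}|lborel. fresnel_density \<alpha> x s * p s"
  show f_meas [measurable]: "?f \<in> borel_measurable borel"
    by (intro borel_measurable_continuous_onI continuous_on_cauchy_mixture_density \<alpha> t)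
  show "0 \<le> ?f x" for x
    using cauchy_mixture_density_pos[OF \<alpha> t] by (rule less_imp_le)
  show "prob_space (density lborel (\<lambda>x. ennreal (?f x)))"
    by (rule prob_space_cauchy_mixture[OF \<alpha> t])
  have eq: "?g x = ?f x" if "x \<noteq> 0" for x
    by (rule subordinated_fresnel_density_eq[OF \<alpha> S p t that])
  \<comment> \<open>The two densities are compared only off 0. Changing one value preserves
    measurability, and a single point is a null set.\<close>
  have "?g = (\<lambda>x. if x = 0 then ?g 0 else ?f x)" using eq by auto
  then have [measurable]: "?g \<in> borel_measurable borel" by (rule ssubst) measurable
  fix A :: "real set" assume [measurable]: "A \<in> sets borel"
  show "subordinated_fresnel_distribution \<alpha> p A = (LINT x:A|lborel. ?f x)"
    unfolding subordinated_fresnel_distribution_def set_lebesgue_integral_def[of _ A]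
  proof (rule integral_cong_AE)
    show "AE x in lborel. indicator A x *\<^sub>R ?g x = indicator A x *\<^sub>R ?f x"
      using AE_lborel_singleton[of 0] by eventually_elim (simp add: eq)
  qed measurable
qed

theorem mainTheorem10:
  fixes \<alpha> :: real and M :: "'a measure" and S :: "real \<Rightarrow> 'a \<Rightarrow> real"
    and h :: "real \<Rightarrow> real \<Rightarrow> real"
  assumes "1 < \<alpha>"
    and "stable_subordinator M (1 / \<alpha>) S"
    and "\<And>t. 0 < t \<Longrightarrow> has_pos_density M (S t) (\<lambda>s. h s t)"
  shows "\<forall>t>0. let f = cauchy_mixture_density \<alpha> t; m = t * sqrt (2 * sin (pi / (2 * \<alpha>)) - 1) in
           has_prob_density (subordinated_fresnel_distribution \<alpha> (\<lambda>s. h s t)) f \<and>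
           (\<forall>x. f x = t * cos (pi / (2 * \<alpha>)) / pi *
                  ((x\<^sup>2 + t\<^sup>2) / (x ^ 4 + t ^ 4 + 2 * x\<^sup>2 * t\<^sup>2 * cos (pi / \<alpha>)))) \<and>
           (\<forall>x. f field_differentiable at x) \<and>
           (\<alpha> < 3 \<longrightarrow>
              {x. deriv f x = 0} = {0, m, - m} \<and> card {x. deriv f x = 0} = 3 \<and>
              bimodal f \<and> modes f = {m, - m} \<and>
              (\<forall>x. f x \<le> f m) \<and> (\<forall>x. f x \<le> f (- m)) \<and>
              is_local_min f 0) \<and>
           (3 \<le> \<alpha> \<longrightarrow>
              {x. deriv f x = 0} = {0} \<and>
              unimodal f \<and> modes f = {0} \<and> (\<forall>x. f x \<le> f 0))"
proof (intro allI impI)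
  fix t :: real assume t: "0 < t"
  note \<alpha> = assms(1)
  show "let f = cauchy_mixture_density \<alpha> t; m = t * sqrt (2 * sin (pi / (2 * \<alpha>)) - 1) in
           has_prob_density (subordinated_fresnel_distribution \<alpha> (\<lambda>s. h s t)) f \<and>
           (\<forall>x. f x = t * cos (pi / (2 * \<alpha>)) / pi *
                  ((x\<^sup>2 + t\<^sup>2) / (x ^ 4 + t ^ 4 + 2 * x\<^sup>2 * t\<^sup>2 * cos (pi / \<alpha>)))) \<and>
           (\<forall>x. f field_differentiable at x) \<and>
           (\<alpha> < 3 \<longrightarrow>
              {x. deriv f x = 0} = {0, m, - m} \<and> card {x. deriv f x = 0} = 3 \<and>
              bimodal f \<and> modes f = {m, - m} \<and>
              (\<forall>x. f x \<le> f m) \<and> (\<forall>x. f x \<le> f (- m)) \<and>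
              is_local_min f 0) \<and>
           (3 \<le> \<alpha> \<longrightarrow>
              {x. deriv f x = 0} = {0} \<and>
              unimodal f \<and> modes f = {0} \<and> (\<forall>x. f x \<le> f 0))"
    unfolding Let_def
    by (intro conjI allI impI subordinated_fresnel_has_prob_density[OF \<alpha> assms(2) assms(3)[OF t] t]
        cauchy_mixture_density_eq[OF \<alpha> t] cauchy_mixture_bimodal[OF \<alpha> t] cauchy_mixture_unimodal[OF \<alpha> t]
        cauchy_mixture_density_field_differentiable[OF \<alpha> t])
qed

end
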